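(* Every factorial poset is $(\mathbf{2}+\mathbf{2})$-free.
   Context: $[n]=\{1,\dots,n\}$. A poset $P$ on $[n]$ (with strict order $<_P$) is naturally labeled if $i<_P j$ implies $i<j$ in the usual order of integers. A factorial poset is a naturally labeled poset $P$ on $[n]$, for some $n$, such that for all $i,j,k\in[n]$: if $i<j$ (usual order) and $j<_P k$, then $i<_P k$. A poset is $(\mathbf{2}+\mathbf{2})$-free if it has no induced subposet isomorphic to the disjoint union of two $2$-element chains (elements of different chains being incomparable). *)

theory Defs
  imports Main
begin

text \<open>
  A poset is given by its carrier \<open>A\<close> and its reflexive order relation \<open>r\<close>, i.e. by
  \<open>partial_order_on A r\<close>; the strict order is \<open>r - Id\<close>.
\<close>

definition naturally_labeled :: "nat \<Rightarrow> nat rel \<Rightarrow> bool" where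
  "naturally_labeled n P \<longleftrightarrow>
     partial_order_on {1..n} P \<and> (\<forall>i j. (i, j) \<in> P - Id \<longrightarrow> i < j)"

definition factorial_poset :: "nat \<Rightarrow> nat rel \<Rightarrow> bool" where
  "factorial_poset n P \<longleftrightarrow>
     naturally_labeled n P \<and>
     (\<forall>i\<in>{1..n}. \<forall>j\<in>{1..n}. \<forall>k\<in>{1..n}.
        i < j \<and> (j, k) \<in> P - Id \<longrightarrow> (i, k) \<in> P - Id)"

definition poset_isomorphic :: "'a set \<Rightarrow> 'a rel \<Rightarrow> 'b set \<Rightarrow> 'b rel \<Rightarrow> bool" where
  "poset_isomorphic A r B s \<longleftrightarrow>
     (\<exists>f. bij_betw f A B \<and> (\<forall>x\<in>A. \<forall>y\<in>A. (x, y) \<in> r \<longleftrightarrow> (f x, f y) \<in> s))"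

definition disjoint_union_order :: "'a rel \<Rightarrow> 'b rel \<Rightarrow> ('a + 'b) rel" where
  "disjoint_union_order r s = map_prod Inl Inl ` r \<union> map_prod Inr Inr ` s"

text \<open>The 2-element chain is realised as \<open>False < True\<close>.\<close>

definition chain2 :: "bool rel" where
  "chain2 = {(x, y). x \<le> y}"

definition two_plus_two :: "(bool + bool) rel" where
  "two_plus_two = disjoint_union_order chain2 chain2"

definition two_plus_two_free :: "'a set \<Rightarrow> 'a rel \<Rightarrow> bool" where
  "two_plus_two_free A r \<longleftrightarrow>
     \<not> (\<exists>B\<subseteq>A. poset_isomorphic B (Restr r B) UNIV two_plus_two)"

end

theory Submission
  imports Defs
begin

text \<open>
  The bottoms \<open>a \<noteq> c\<close> of two chains \<open>a <\<^sub>P b\<close> and \<open>c <\<^sub>P d\<close> are distinct integers, hence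
  comparable in the usual order. If \<open>a < c\<close>, the defining condition of a factorial poset applied to
  \<open>a < c <\<^sub>P d\<close> gives \<open>a <\<^sub>P d\<close>; symmetrically, \<open>c < a\<close> gives \<open>c <\<^sub>P b\<close>. So one of the bottoms
  always lies below the top of the other chain, which an induced disjoint union of the chains forbids.
\<close>

text \<open>An isomorphism onto \<open>two_plus_two\<close> is used only through the preimages of its four points:
  \<open>a, b\<close> come from the \<open>Inl\<close> chain and \<open>c, d\<close> from the \<open>Inr\<close> chain.\<close>

lemma not_two_plus_two_freeE:
  assumes "\<not> two_plus_two_free A r"
  obtains a b c d where "a \<in> A" "b \<in> A" "c \<in> A" "d \<in> A" "a \<noteq> c"
    "(a, b) \<in> r - Id" "(c, d) \<in> r - Id" "(a, d) \<notin> r" "(c, b) \<notin> r"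
proof -
  obtain B f where "B \<subseteq> A" and bij: "bij_betw f B UNIV"
    and iso: "\<And>x y. x \<in> B \<Longrightarrow> y \<in> B \<Longrightarrow> (x, y) \<in> Restr r B \<longleftrightarrow> (f x, f y) \<in> two_plus_two"
    using assms unfolding two_plus_two_free_def poset_isomorphic_def by blast
  define g where "g = inv_into B f"
  have f_g: "f (g u) = u" for u
    unfolding g_def by (rule bij_betw_inv_into_right[OF bij UNIV_I])
  have g_B: "g u \<in> B" for u
    using bij_betw_apply[OF bij_betw_inv_into[OF bij]] by (simp add: g_def)
  have g_eq: "g u = g v \<longleftrightarrow> u = v" for u v
    by (metis f_g)
  have rel: "(g u, g v) \<in> r \<longleftrightarrow> (u, v) \<in> two_plus_two" for u v
    using iso[OF g_B g_B, of u v] g_B by (simp add: f_g)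
  show thesis
  proof (rule that)
    show "g (Inl False) \<in> A" "g (Inl True) \<in> A" "g (Inr False) \<in> A" "g (Inr True) \<in> A"
      using g_B \<open>B \<subseteq> A\<close> by blast+
    show "g (Inl False) \<noteq> g (Inr False)"
      by (simp add: g_eq)
    show "(g (Inl False), g (Inl True)) \<in> r - Id" "(g (Inr False), g (Inr True)) \<in> r - Id"
      "(g (Inl False), g (Inr True)) \<notin> r" "(g (Inr False), g (Inl True)) \<notin> r"
      by (auto simp: rel g_eq two_plus_two_def disjoint_union_order_def chain2_def image_iff)
  qed
qed

theorem proposition4:
  fixes n :: nat and P :: "nat rel"
  assumes "factorial_poset n P"
  shows "two_plus_two_free {1..n} P"
proof (rule ccontr)
  assume "\<not> two_plus_two_free {1..n} P"
  then obtain a b c d where in_carrier: "a \<in> {1..n}" "b \<in> {1..n}" "c \<in> {1..n}" "d \<in> {1..n}"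
    and "a \<noteq> c"
    and chains: "(a, b) \<in> P - Id" "(c, d) \<in> P - Id"
    and incomparable: "(a, d) \<notin> P" "(c, b) \<notin> P"
    by (rule not_two_plus_two_freeE)
  have factorial: "(i, k) \<in> P"
    if "i \<in> {1..n}" "j \<in> {1..n}" "k \<in> {1..n}" "i < j" "(j, k) \<in> P - Id" for i j k
    using assms that unfolding factorial_poset_def by blast
  from \<open>a \<noteq> c\<close> consider "a < c" | "c < a"
    by linarith
  then show False
  proof cases
    case 1
    with in_carrier chains incomparable factorial[of a c d] show False by blast
  next
    case 2
    with in_carrier chains incomparable factorial[of c a b] show False by blast
  qed
qed

end
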